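(* Let $q\in\mathbb{N}$ with $q\ge2$, let $a_k=q^k$ for $k\in\mathbb{N}$, let $f\colon\mathbb{R}\to\mathbb{R}$ be a continuous $1$-periodic function, and let $U$ be a random variable uniformly distributed on $[0,1]$. Put $S_n:=\sum_{k=1}^n f(a_kU)$, $n\in\mathbb{N}$. Then $(S_n/n)_{n\in\mathbb{N}}$ satisfies a large deviation principle in $\mathbb{R}$ at speed $n$ and with some good rate function $\mathbb{I}_q^f\colon\mathbb{R}\to[0,\infty]$.
   Context: A sequence $(X_n)_{n\in\mathbb{N}}$ of real random variables satisfies a large deviation principle (LDP) in $\mathbb{R}$ at speed $(s_n)_{n\in\mathbb{N}}$ (positive reals tending to infinity) with rate function $\mathbb{I}\colon\mathbb{R}\to[0,\infty]$ if $\mathbb{I}$ is lower semicontinuous and for every Borel set $A\subset\mathbb{R}$ $$-\inf_{x\in A^\circ}\mathbb{I}(x)\le\liminf_{n\to\infty}\frac1{s_n}\log\mathbb{P}[X_n\in A]\le\limsup_{n\to\infty}\frac1{s_n}\log\mathbb{P}[X_n\in A]\le-\inf_{x\in\overline{A}}\mathbb{I}(x),$$ where $A^\circ$ and $\overline{A}$ are the interior and closure of $A$. "Speed $n$" means $s_n=n$. The rate function is called good if it has compact level sets $\{x : \mathbb{I}(x)\le c\}$, $c\in[0,\infty)$. *)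

theory Defs
  imports "HOL-Probability.Probability"
begin

definition lower_semicontinuous :: "(real \<Rightarrow> ennreal) \<Rightarrow> bool" where
  "lower_semicontinuous I \<longleftrightarrow> (\<forall>x. I x \<le> Liminf (at x) I)"

(* log 0 = -\<infinity>, whereas the library has ln 0 = 0. *)
definition ext_ln :: "real \<Rightarrow> ereal" where
  "ext_ln p = (if p = 0 then -\<infinity> else ereal (ln p))"

(* Sequences are indexed by n \<ge> 1; the values at 0 do not affect the limits.
   The infimum is taken in ennreal, so that it is \<infinity> over the empty set. *)
definition satisfies_LDP ::
    "'a measure \<Rightarrow> (nat \<Rightarrow> 'a \<Rightarrow> real) \<Rightarrow> (nat \<Rightarrow> real) \<Rightarrow> (real \<Rightarrow> ennreal) \<Rightarrow> bool" where
  "satisfies_LDP M X s I \<longleftrightarrow>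
     (\<forall>n\<ge>1. X n \<in> borel_measurable M) \<and>
     (\<forall>n\<ge>1. s n > 0) \<and> filterlim s at_top sequentially \<and>
     lower_semicontinuous I \<and>
     (\<forall>A\<in>sets borel.
        - enn2ereal (INF x\<in>interior A. I x)
          \<le> liminf (\<lambda>n. ereal (1 / s n) * ext_ln (measure M {\<omega>\<in>space M. X n \<omega> \<in> A})) \<and>
        liminf (\<lambda>n. ereal (1 / s n) * ext_ln (measure M {\<omega>\<in>space M. X n \<omega> \<in> A}))
          \<le> limsup (\<lambda>n. ereal (1 / s n) * ext_ln (measure M {\<omega>\<in>space M. X n \<omega> \<in> A})) \<and>
        limsup (\<lambda>n. ereal (1 / s n) * ext_ln (measure M {\<omega>\<in>space M. X n \<omega> \<in> A}))
          \<le> - enn2ereal (INF x\<in>closure A. I x))"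

definition good_rate_function :: "(real \<Rightarrow> ennreal) \<Rightarrow> bool" where
  "good_rate_function I \<longleftrightarrow> lower_semicontinuous I \<and> (\<forall>c<\<infinity>. compact {x. I x \<le> c})"

end

theory Submission
  imports Defs
begin

text \<open>
  Let \<open>N = q ^ m\<close>. For \<open>u\<close> uniform on the unit interval, the first \<open>m\<close> digits of \<open>u\<close> in
  base \<open>q\<close> (the integer part of \<open>N u\<close>) are independent of the fractional part of \<open>N u\<close>, which
  is again uniform, and by periodicity \<open>S (m + n) u = S m u + S n (N u)\<close>, where the last term
  depends on that fractional part only. The term \<open>S m u\<close> is almost a function of the first \<open>m\<close>
  digits: by uniform continuity of \<open>f\<close>, it oscillates by at most \<open>o(m)\<close> on each interval on which
  these digits are constant (\<open>S_oscillation\<close>). So the probabilities that \<open>S n / n\<close> is close to a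
  given point \<open>a\<close> are supermultiplicative in \<open>n\<close>, up to enlarging the neighbourhood of \<open>a\<close> by an
  arbitrarily small amount (\<open>measure_deviation_set_supermult\<close>).

  As in Fekete's lemma, supermultiplicativity makes the lower and the upper exponential decay rates
  of these probabilities agree, again up to enlarging the neighbourhood
  (\<open>limsup_le_liminf_cball\<close>). The common rate of decay near \<open>a\<close>, for ever smaller
  neighbourhoods, defines the rate function. The lower bound of the large deviation principle is
  then local, and the upper bound follows by covering with finitely many small balls, because the
  means \<open>S n / n\<close> all lie in the compact interval \<open>[-K, K]\<close> with \<open>K\<close> a bound of
  \<open>\<bar>f\<bar>\<close>.
\<close>

section \<open>Logarithmic scaling\<close>

lemma scaled_ext_ln_le_iff:
  assumes "n > 0" "p \<ge> 0"
  shows "ereal (1 / n) * ext_ln p \<le> ereal c \<longleftrightarrow> p \<le> exp (n * c)"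
proof (cases "p = 0")
  case True
  then show ?thesis using assms by (simp add: ext_ln_def)
next
  case False
  then have "ereal (1 / n) * ext_ln p = ereal (ln p / n)"
    by (simp add: ext_ln_def)
  moreover have "ln p / n \<le> c \<longleftrightarrow> p \<le> exp (n * c)"
    using assms False
    by (simp add: pos_divide_le_eq mult.commute ln_le_cancel_iff[symmetric] del: ln_le_cancel_iff)
  ultimately show ?thesis by simp
qed

lemma scaled_ext_ln_mono:
  assumes "n \<ge> 0" "0 \<le> p" "p \<le> r"
  shows "ereal (1 / n) * ext_ln p \<le> ereal (1 / n) * ext_ln r"
  using assms by (intro ereal_mult_left_mono) (auto simp: ext_ln_def)

section \<open>Oscillation of the lacunary sums\<close>

locale lacunary =
  fixes q :: nat and f :: "real \<Rightarrow> real"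
  assumes q_ge: "q \<ge> 2"
    and cont_f: "continuous_on UNIV f"
    and periodic_f: "\<And>x. f (x + 1) = f x"
begin

lemma f_add_nat: "f (x + real k) = f x"
  by (induction k) (use periodic_f[of "x + real _"] in \<open>auto simp: add_ac\<close>)

lemma f_add_int: "f (x + of_int k) = f x"
proof (cases "k \<ge> 0")
  case True
  then show ?thesis using f_add_nat[of x "nat k"] by simp
next
  case False
  then show ?thesis using f_add_nat[of "x + of_int k" "nat (-k)"] by simp
qed

lemma uniformly_continuous_f:
  assumes "e > 0"
  obtains d where "d > 0" "\<And>x y. \<bar>x - y\<bar> < d \<Longrightarrow> \<bar>f x - f y\<bar> < e"
proof -
  have "uniformly_continuous_on {-1..2} f"
    by (intro compact_uniformly_continuous continuous_on_subset[OF cont_f]) auto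
  then obtain d where d: "d > 0"
    "\<And>x y. x \<in> {-1..2} \<Longrightarrow> y \<in> {-1..2} \<Longrightarrow> \<bar>x - y\<bar> < d \<Longrightarrow> \<bar>f x - f y\<bar> < e"
    using assms unfolding uniformly_continuous_on_def dist_real_def by metis
  show ?thesis
  proof (rule that[of "min d 1"])
    show "min d 1 > 0" using d by simp
    fix x y :: real assume xy: "\<bar>x - y\<bar> < min d 1"
    define k where "k = - \<lfloor>x\<rfloor>"
    \<comment> \<open>Shifting both points by \<open>k\<close> brings \<open>x\<close> into \<open>[0, 1]\<close> and \<open>y\<close> into \<open>[-1, 2]\<close>.\<close>
    have "x + of_int k \<in> {0..1}" unfolding k_def by (simp; linarith)
    then have "\<bar>f (x + of_int k) - f (y + of_int k)\<bar> < e"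
      using xy by (intro d) auto
    then show "\<bar>f x - f y\<bar> < e" by (simp add: f_add_int)
  qed
qed

lemma bounded_f:
  obtains K where "K > 0" "\<And>x. \<bar>f x\<bar> \<le> K"
proof -
  have "compact (f ` {0..1})"
    by (intro compact_continuous_image continuous_on_subset[OF cont_f]) auto
  then obtain K where K: "K > 0" "\<And>x. x \<in> {0..1} \<Longrightarrow> \<bar>f x\<bar> \<le> K"
    using compact_imp_bounded[of "f ` {0..1}"] unfolding bounded_pos by auto
  have "\<bar>f x\<bar> \<le> K" for x
  proof -
    have "x + of_int (- \<lfloor>x\<rfloor>) \<in> {0..1}" by (simp; linarith)
    then show ?thesis using K(2) f_add_int[of x "- \<lfloor>x\<rfloor>"] by metis
  qed
  with K(1) show ?thesis by (rule that)
qed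

definition S :: "nat \<Rightarrow> real \<Rightarrow> real" where
  "S n u = (\<Sum>k=1..n. f (real (q ^ k) * u))"

lemma S_add: "S (m + n) u = S m u + S n (real (q ^ m) * u)"
proof (induction n)
  case (Suc n)
  then show ?case
    by (simp add: S_def power_add mult_ac)
qed (simp add: S_def)

lemma S_diff_nat: "S n (u - real i) = S n u"
proof -
  have "f (real (q ^ k) * (u - real i)) = f (real (q ^ k) * u)" for k
    using f_add_nat[of "real (q ^ k) * (u - real i)" "q ^ k * i"] by (simp add: algebra_simps)
  then show ?thesis by (simp add: S_def)
qed

lemma continuous_on_S: "continuous_on UNIV (S n)"
  unfolding S_def by (intro continuous_intros continuous_on_compose2[OF cont_f]) auto

lemma borel_measurable_S [measurable]: "S n \<in> borel_measurable borel"
  by (intro borel_measurable_continuous_onI continuous_on_S)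

lemma abs_S_le:
  assumes "\<And>x. \<bar>f x\<bar> \<le> K"
  shows "\<bar>S n u\<bar> \<le> real n * K"
  unfolding S_def using sum_bounded_above[of "{1..n}" "\<lambda>k. \<bar>f (real (q ^ k) * u)\<bar>" K] assms
  by (intro order_trans[OF sum_abs]) auto

text \<open>
  If \<open>u\<close> and \<open>v\<close> are at distance at most \<open>q ^ (-m)\<close>, then the arguments of the \<open>k\<close>-th
  summands are at distance at most \<open>q ^ (k - m)\<close>. All but the last \<open>J\<close> summands therefore differ
  by little, where \<open>J\<close> depends on the modulus of continuity of \<open>f\<close> only, and the last \<open>J\<close>
  summands contribute a bounded amount, which is negligible against \<open>m\<close>.
\<close>
lemma S_oscillation:
  assumes "e > 0"
  obtains m0 where "m0 \<ge> 1"
    "\<And>m u v. m \<ge> m0 \<Longrightarrow> \<bar>u - v\<bar> \<le> 1 / real (q ^ m) \<Longrightarrow> \<bar>S m u - S m v\<bar> \<le> real m * e"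
proof -
  obtain d where d: "d > 0" "\<And>x y. \<bar>x - y\<bar> < d \<Longrightarrow> \<bar>f x - f y\<bar> < e / 2"
    using uniformly_continuous_f[of "e / 2"] assms by auto
  obtain K where K: "K > 0" "\<And>x. \<bar>f x\<bar> \<le> K"
    using bounded_f by blast
  have q: "real q > 1" using q_ge by simp
  obtain J where J: "1 / d < real q ^ J"
    using real_arch_pow[OF q] by blast
  obtain m1 where m1: "4 * K * real J / e \<le> real m1"
    using real_arch_simple by blast
  show ?thesis
  proof (rule that[of "max 1 (max J m1)"])
    fix m u v
    assume m: "m \<ge> max 1 (max J m1)" and uv: "\<bar>u - v\<bar> \<le> 1 / real (q ^ m)"
    define g where "g k = \<bar>f (real (q ^ k) * u) - f (real (q ^ k) * v)\<bar>" for k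
    have early: "g k \<le> e / 2" if "k \<le> m - J" for k
    proof -
      have "k + J \<le> m" using that m by linarith
      then have "real q ^ (k + J) \<le> real q ^ m"
        using q by (intro power_increasing) auto
      then have "real q ^ k * \<bar>u - v\<bar> \<le> 1 / real q ^ J"
        using uv q mult_left_mono[OF uv, of "real q ^ k"]
        by (simp add: power_add field_simps)
           (smt (verit, best) mult_left_mono mult.commute mult.assoc zero_le_power zero_less_power)
      also have "\<dots> < d" using J d(1) q by (simp add: field_simps)
      finally have "\<bar>real (q ^ k) * u - real (q ^ k) * v\<bar> < d"
        using q by (simp add: abs_mult right_diff_distrib[symmetric])
      then show ?thesis unfolding g_def using d(2) by fastforce
    qed
    have late: "g k \<le> 2 * K" for k
      using K(2)[of "real (q ^ k) * u"] K(2)[of "real (q ^ k) * v"] unfolding g_def by linarith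
    have "\<bar>S m u - S m v\<bar> \<le> (\<Sum>k=1..m. g k)"
      unfolding S_def g_def sum_subtractf[symmetric] by (rule sum_abs)
    also have "\<dots> = (\<Sum>k\<in>{1..m - J}. g k) + (\<Sum>k\<in>{m - J<..m}. g k)"
      by (subst sum.union_disjoint[symmetric]) (auto intro!: sum.cong)
    also have "\<dots> \<le> real (m - J) * (e / 2) + real J * (2 * K)"
    proof (rule add_mono)
      show "sum g {1..m - J} \<le> real (m - J) * (e / 2)"
        using sum_bounded_above[of "{1..m - J}" g "e / 2"] early by simp
      show "sum g {m - J<..m} \<le> real J * (2 * K)"
        using sum_bounded_above[of "{m - J<..m}" g "2 * K"] late m by simp
    qed
    also have "\<dots> \<le> real m * (e / 2) + real m * (e / 2)"
    proof (rule add_mono)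
      show "real (m - J) * (e / 2) \<le> real m * (e / 2)" using assms by simp
      have "4 * K * real J / e \<le> real m" using m1 m by linarith
      then show "real J * (2 * K) \<le> real m * (e / 2)"
        using assms by (simp add: field_simps)
    qed
    finally show "\<bar>S m u - S m v\<bar> \<le> real m * e" by (simp add: mult.commute)
  qed simp
qed

section \<open>Supermultiplicativity of deviation probabilities\<close>

definition deviation_set :: "nat \<Rightarrow> real \<Rightarrow> real \<Rightarrow> real set" where
  "deviation_set n b r = {u \<in> {0..<1}. \<bar>S n u - b\<bar> \<le> r}"

lemma fmeasurable_unit:
  assumes "{u. Q u} \<in> sets borel"
  shows "{u \<in> {0..<1::real}. Q u} \<in> fmeasurable lborel"
proof (rule fmeasurableI2)
  show "{0..1::real} \<in> fmeasurable lborel" by (auto simp: fmeasurable_def)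
  have "{u \<in> {0..<1::real}. Q u} = {0..<1} \<inter> {u. Q u}" by auto
  then show "{u \<in> {0..<1::real}. Q u} \<in> sets lborel" using assms by simp
qed auto

lemma fmeasurable_deviation_set: "deviation_set n b r \<in> fmeasurable lborel"
  unfolding deviation_set_def by (intro fmeasurable_unit) measurable

lemma sets_deviation_set [simp]: "deviation_set n b r \<in> sets borel"
  using fmeasurable_deviation_set[of n b r] by (simp add: fmeasurable_def)

lemma measure_deviation_set_mono:
  assumes "\<And>u. u \<in> deviation_set n b r \<Longrightarrow> u \<in> deviation_set n' b' r'"
  shows "measure lborel (deviation_set n b r) \<le> measure lborel (deviation_set n' b' r')"
  using assms fmeasurable_deviation_set by (intro measure_mono_fmeasurable) (auto simp: fmeasurable_def)

text \<open>
  Independence of the leading \<open>m\<close> digits and the remaining ones. Let \<open>D\<close> be the set of leading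
  blocks of \<open>m\<close> digits for which some point with this block belongs to the deviation set of
  \<open>S m\<close>; this deviation set has measure at most \<open>card D / q ^ m\<close>. By the bound \<open>c\<close> on the
  oscillation, every point whose leading block is in \<open>D\<close> satisfies the condition on \<open>S m\<close> with
  \<open>r + c\<close> in place of \<open>r\<close>. For each block in \<open>D\<close>, the points with this block whose remaining
  digits fulfil the condition on \<open>S n\<close> form a copy of the deviation set of \<open>S n\<close>, scaled down by
  \<open>q ^ m\<close>.
\<close>
lemma measure_deviation_set_supermult:
  assumes osc: "\<And>u v. \<bar>u - v\<bar> \<le> 1 / real (q ^ m) \<Longrightarrow> \<bar>S m u - S m v\<bar> \<le> c"
  shows "measure lborel (deviation_set m b r) * measure lborel (deviation_set n b' r')
    \<le> measure lborel (deviation_set (m + n) (b + b') (r + c + r'))"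
proof -
  define N where "N = real (q ^ m)"
  have N: "N > 0" using q_ge by (simp add: N_def)
  \<comment> \<open>The points whose first \<open>m\<close> digits are those of the integer \<open>i\<close>.\<close>
  define cyl where "cyl i = {real i / N ..< (real i + 1) / N}" for i :: nat
  have cyl_iff: "u \<in> cyl i \<longleftrightarrow> real i \<le> N * u \<and> N * u < real i + 1" for u i
    using N by (auto simp: cyl_def field_simps)
  have cyl_fm: "cyl i \<in> fmeasurable lborel" for i
    using N by (simp add: cyl_def fmeasurable_def divide_right_mono)
  define D where "D = {i \<in> {..<q ^ m}. cyl i \<inter> deviation_set m b r \<noteq> {}}"
  have fin: "finite D" by (simp add: D_def)
  define piece where "piece i = (\<lambda>x. (1 / N) * x + real i / N) ` deviation_set n b' r'" for i :: nat
  have piece_iff: "u \<in> piece i \<longleftrightarrow> N * u - real i \<in> deviation_set n b' r'" for u i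
  proof
    assume "N * u - real i \<in> deviation_set n b' r'"
    moreover have "u = (1 / N) * (N * u - real i) + real i / N" using N by (simp add: field_simps)
    ultimately show "u \<in> piece i" unfolding piece_def by blast
  qed (use N in \<open>auto simp: piece_def field_simps\<close>)
  have piece_cyl: "piece i \<subseteq> cyl i" for i
    by (auto simp: piece_iff cyl_iff deviation_set_def)
  have piece_eq: "piece i = (\<lambda>u. N * u - real i) -` deviation_set n b' r'" for i
    by (auto simp: piece_iff)
  have piece_sets: "piece i \<in> sets lborel" for i
    unfolding piece_eq using fmeasurable_deviation_set[of n b' r']
    by (auto intro!: measurable_sets_borel[where M = borel] simp: fmeasurable_def)
  have piece_fm: "piece i \<in> fmeasurable lborel" for i
    by (rule fmeasurableI2[OF cyl_fm piece_cyl piece_sets])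
  have meas_piece: "measure lborel (piece i) = measure lborel (deviation_set n b' r') / N" for i
  proof -
    have "measure lebesgue (piece i) = \<bar>1 / N\<bar> * measure lebesgue (deviation_set n b' r')"
      using measure_lebesgue_affine[of "1 / N" "real i / N" "deviation_set n b' r'"] by (simp add: piece_def)
    then show ?thesis
      using piece_sets[of i] fmeasurable_deviation_set[of n b' r'] N
      by (simp add: measure_completion fmeasurable_def)
  qed
  have "deviation_set m b r \<subseteq> (\<Union>i\<in>D. cyl i)"
  proof
    fix u assume u: "u \<in> deviation_set m b r"
    define i where "i = nat \<lfloor>N * u\<rfloor>"
    have "0 \<le> N * u" "N * u < N" using u N by (auto simp: deviation_set_def)
    then have "u \<in> cyl i" "real i < N" unfolding cyl_iff i_def by linarith+
    then show "u \<in> (\<Union>i\<in>D. cyl i)" using u by (auto simp: D_def N_def)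
  qed
  then have "measure lborel (deviation_set m b r) \<le> measure lborel (\<Union>i\<in>D. cyl i)"
    using fmeasurable_deviation_set fin cyl_fm
    by (intro measure_mono_fmeasurable fmeasurable.finite_UN) auto
  also have "\<dots> \<le> (\<Sum>i\<in>D. measure lborel (cyl i))"
    using fin by (intro measure_UNION_le) (auto simp: cyl_def)
  also have "\<dots> = real (card D) / N"
    using N by (simp add: cyl_def divide_right_mono diff_divide_distrib[symmetric])
  finally have le: "measure lborel (deviation_set m b r) \<le> real (card D) / N" .
  have "measure lborel (deviation_set m b r) * measure lborel (deviation_set n b' r')
      \<le> real (card D) / N * measure lborel (deviation_set n b' r')"
    by (intro mult_right_mono le) simp
  also have "\<dots> = (\<Sum>i\<in>D. measure lborel (piece i))" by (simp add: meas_piece)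
  also have "\<dots> = measure lborel (\<Union>i\<in>D. piece i)"
  proof (rule measure_finite_Union[symmetric])
    have "i = j" if "u \<in> cyl i" "u \<in> cyl j" for u i j
      using that unfolding cyl_iff by linarith
    then show "disjoint_family_on piece D"
      using piece_cyl unfolding disjoint_family_on_def by blast
    show "emeasure lborel (piece i) \<noteq> \<infinity>" for i
      using piece_fm[of i] by (auto simp: fmeasurable_def)
  qed (use fin piece_sets in auto)
  also have "\<dots> \<le> measure lborel (deviation_set (m + n) (b + b') (r + c + r'))"
  proof (rule measure_mono_fmeasurable)
    show "(\<Union>i\<in>D. piece i) \<subseteq> deviation_set (m + n) (b + b') (r + c + r')"
    proof
      fix u assume "u \<in> (\<Union>i\<in>D. piece i)"
      then obtain i where i: "i \<in> D" "u \<in> piece i" by auto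
      then obtain v where v: "v \<in> cyl i" "v \<in> deviation_set m b r" and "i < q ^ m"
        unfolding D_def by auto
      then have iN: "real i + 1 \<le> N" unfolding N_def by linarith
      have u: "u \<in> cyl i" using i piece_cyl by auto
      have "N * \<bar>u - v\<bar> = \<bar>N * u - N * v\<bar>"
        using N by (simp add: abs_mult right_diff_distrib[symmetric])
      also have "\<dots> \<le> 1" using u v(1) unfolding cyl_iff by linarith
      finally have "\<bar>u - v\<bar> \<le> 1 / real (q ^ m)"
        unfolding N_def[symmetric] using N by (simp add: pos_le_divide_eq mult.commute)
      from osc[OF this] have "\<bar>S m u - b\<bar> \<le> r + c"
        using v(2) unfolding deviation_set_def mem_Collect_eq by linarith
      moreover have "\<bar>S n (N * u) - b'\<bar> \<le> r'"
        using i(2) S_diff_nat[of n "N * u" i] by (simp add: piece_iff deviation_set_def)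
      moreover have "S (m + n) u = S m u + S n (N * u)" by (simp only: S_add N_def)
      moreover have "0 \<le> N * u" "N * u < N" using u iN unfolding cyl_iff by linarith+
      then have "0 \<le> u" "u < 1" using N by (auto simp: zero_le_mult_iff)
      ultimately show "u \<in> deviation_set (m + n) (b + b') (r + c + r')" by (simp add: deviation_set_def)
    qed
  qed (use fin piece_sets fmeasurable_deviation_set in auto)
  finally show ?thesis .
qed

lemma measure_deviation_set_power:
  assumes osc: "\<And>u v. \<bar>u - v\<bar> \<le> 1 / real (q ^ m) \<Longrightarrow> \<bar>S m u - S m v\<bar> \<le> c"
  shows "measure lborel (deviation_set m b r) ^ k
    \<le> measure lborel (deviation_set (k * m) (real k * b) (real k * (r + c)))"
proof (induction k)
  case 0
  have "deviation_set 0 0 0 = {0..<1}" by (auto simp: deviation_set_def S_def)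
  then show ?case by simp
next
  case (Suc k)
  have "measure lborel (deviation_set m b r) ^ Suc k
      \<le> measure lborel (deviation_set m b r) * measure lborel (deviation_set (k * m) (real k * b) (real k * (r + c)))"
    using Suc.IH by (simp add: mult_left_mono)
  also have "\<dots> \<le> measure lborel (deviation_set (m + k * m) (b + real k * b) (r + c + real k * (r + c)))"
    by (rule measure_deviation_set_supermult[OF osc])
  finally show ?case by (simp add: algebra_simps)
qed

section \<open>Exponential rates of the means\<close>

definition prob_mean :: "nat \<Rightarrow> real set \<Rightarrow> real" where
  "prob_mean n A = measure lborel {u \<in> {0..<1}. S n u / real n \<in> A}"

definition rate_at :: "nat \<Rightarrow> real set \<Rightarrow> ereal" where
  "rate_at n A = ereal (1 / real n) * ext_ln (prob_mean n A)"

lemma fmeasurable_mean: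
  assumes [measurable]: "A \<in> sets borel"
  shows "{u \<in> {0..<1}. S n u / real n \<in> A} \<in> fmeasurable lborel"
  by (intro fmeasurable_unit) measurable

lemma prob_mean_nonneg: "0 \<le> prob_mean n A"
  by (simp add: prob_mean_def)

lemma prob_mean_mono:
  assumes "A \<subseteq> B" "A \<in> sets borel" "B \<in> sets borel"
  shows "prob_mean n A \<le> prob_mean n B"
  unfolding prob_mean_def using assms fmeasurable_mean[of A n] fmeasurable_mean[of B n]
  by (intro measure_mono_fmeasurable) (auto simp: fmeasurable_def)

lemma prob_mean_le_1:
  assumes "A \<in> sets borel"
  shows "prob_mean n A \<le> 1"
proof -
  have "prob_mean n A \<le> measure lborel {0..<1::real}"
    unfolding prob_mean_def using fmeasurable_mean[OF assms, of n]
    by (intro measure_mono_fmeasurable) (auto simp: fmeasurable_def)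
  then show ?thesis by simp
qed

text \<open>
  The cover has to contain only those points of \<open>A\<close> that the mean can attain: a set \<open>A\<close> that is not
  bounded need not lie in a finite union of balls.
\<close>
lemma prob_mean_le_sum:
  assumes "finite F" "A \<inter> range (\<lambda>u. S n u / real n) \<subseteq> (\<Union>i\<in>F. B i)" "A \<in> sets borel"
    "\<And>i. i \<in> F \<Longrightarrow> B i \<in> sets borel"
  shows "prob_mean n A \<le> (\<Sum>i\<in>F. prob_mean n (B i))"
proof -
  let ?E = "\<lambda>A. {u \<in> {0..<1}. S n u / real n \<in> A}"
  have "measure lborel (?E A) \<le> measure lborel (\<Union>i\<in>F. ?E (B i))"
  proof (rule measure_mono_fmeasurable)
    show "?E A \<subseteq> (\<Union>i\<in>F. ?E (B i))" using assms(2) by fastforce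
    show "?E A \<in> sets lborel" using fmeasurable_mean[OF assms(3)] by (rule fmeasurableD)
    show "(\<Union>i\<in>F. ?E (B i)) \<in> fmeasurable lborel"
      using assms(1,4) by (intro fmeasurable.finite_UN fmeasurable_mean) auto
  qed
  also have "\<dots> \<le> (\<Sum>i\<in>F. measure lborel (?E (B i)))"
    using assms fmeasurable_mean by (intro measure_UNION_le) (auto simp: fmeasurable_def)
  finally show ?thesis by (simp add: prob_mean_def)
qed

lemma prob_mean_cball:
  assumes "n \<ge> 1"
  shows "prob_mean n (cball a r) = measure lborel (deviation_set n (real n * a) (real n * r))"
proof -
  have "S n u / real n \<in> cball a r \<longleftrightarrow> \<bar>S n u - real n * a\<bar> \<le> real n * r" for u
  proof -
    have "\<bar>S n u - real n * a\<bar> = real n * dist a (S n u / real n)"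
      using assms abs_mult[of "real n" "a - S n u / real n"]
      by (simp add: dist_real_def right_diff_distrib abs_minus_commute)
    then show ?thesis using assms by (simp add: mult_le_cancel_left_pos)
  qed
  then show ?thesis by (simp add: prob_mean_def deviation_set_def)
qed

lemma rate_at_mono:
  assumes "A \<subseteq> B" "A \<in> sets borel" "B \<in> sets borel"
  shows "rate_at n A \<le> rate_at n B"
  unfolding rate_at_def using assms by (intro scaled_ext_ln_mono prob_mean_nonneg prob_mean_mono) auto

lemma rate_at_le_iff:
  assumes "n \<ge> 1"
  shows "rate_at n A \<le> ereal c \<longleftrightarrow> prob_mean n A \<le> exp (real n * c)"
  unfolding rate_at_def using assms by (intro scaled_ext_ln_le_iff prob_mean_nonneg) auto

text \<open>The constant factor \<open>C\<close> absorbs the number of balls in a finite cover.\<close>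
lemma limsup_rate_le:
  assumes "C > 0" "eventually (\<lambda>n. prob_mean n A \<le> C * exp (real n * c)) sequentially"
  shows "limsup (\<lambda>n. rate_at n A) \<le> ereal c"
proof -
  have "limsup (\<lambda>n. rate_at n A) \<le> limsup (\<lambda>n. ereal (ln C / real n + c))"
  proof (rule Limsup_mono)
    show "eventually (\<lambda>n. rate_at n A \<le> ereal (ln C / real n + c)) sequentially"
      using assms(2) eventually_ge_at_top[of 1]
    proof eventually_elim
      case (elim n)
      then have "exp (real n * (ln C / real n + c)) = C * exp (real n * c)"
        using assms(1) by (simp add: distrib_left exp_add)
      then show ?case using elim by (simp only: rate_at_le_iff)
    qed
  qed
  also have "(\<lambda>n. ln C / real n + c) \<longlonglongrightarrow> 0 + c"
    by (intro tendsto_add tendsto_const lim_const_over_n)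
  then have "limsup (\<lambda>n. ereal (ln C / real n + c)) = ereal c"
    by (intro lim_imp_Limsup) auto
  finally show ?thesis .
qed

text \<open>
  This is the step of Fekete's lemma. For a fixed large \<open>m\<close>, write \<open>n = k m + l\<close> with \<open>l < m\<close>. The
  probability for \<open>n\<close> is at least the \<open>k\<close>-th power of the one for \<open>m\<close>, and \<open>k \<le> n / m\<close>. The
  radius grows from \<open>r\<close> to \<open>3 r\<close>: one \<open>r\<close> is spent on the oscillation of \<open>S m\<close>, another one on the
  remaining \<open>l\<close> summands.
\<close>
lemma limsup_le_liminf_cball:
  assumes "r > 0"
  shows "limsup (\<lambda>n. rate_at n (cball a r)) \<le> liminf (\<lambda>n. rate_at n (cball a (3 * r)))"
proof -
  obtain m0 where m0: "m0 \<ge> 1"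
    "\<And>m u v. m \<ge> m0 \<Longrightarrow> \<bar>u - v\<bar> \<le> 1 / real (q ^ m) \<Longrightarrow> \<bar>S m u - S m v\<bar> \<le> real m * r"
    using S_oscillation[OF assms] by metis
  obtain K where K: "K > 0" "\<And>x. \<bar>f x\<bar> \<le> K"
    using bounded_f by blast
  have "rate_at m (cball a r) \<le> liminf (\<lambda>n. rate_at n (cball a (3 * r)))" if m: "m \<ge> m0" for m
  proof (cases "prob_mean m (cball a r) = 0")
    case True
    then show ?thesis using m m0(1) by (simp add: rate_at_def ext_ln_def)
  next
    case False
    define p where "p = prob_mean m (cball a r)"
    have p: "0 < p" "p \<le> 1"
      using False prob_mean_nonneg[of m "cball a r"] prob_mean_le_1[of "cball a r" m] by (auto simp: p_def)
    have m1: "m \<ge> 1" using m m0(1) by simp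
    obtain n1 where n1: "real m * (K + \<bar>a\<bar>) / r \<le> real n1"
      using real_arch_simple by blast
    show ?thesis
    proof (rule Liminf_bounded)
      show "eventually (\<lambda>n. rate_at m (cball a r) \<le> rate_at n (cball a (3 * r))) sequentially"
        using eventually_ge_at_top[of "max 1 n1"]
      proof eventually_elim
        case (elim n)
        define k l where "k = n div m" and "l = n mod m"
        have n: "n = k * m + l" by (simp add: k_def l_def)
        have l: "l \<le> m" using m1 by (simp add: l_def less_imp_le)
        have km: "real k * real m \<le> real n" unfolding n by simp
        have rem: "real l * (K + \<bar>a\<bar>) \<le> real n * r"
        proof -
          have "real l * (K + \<bar>a\<bar>) \<le> real m * (K + \<bar>a\<bar>)"
            using l K by (intro mult_right_mono) auto
          also have "\<dots> \<le> real n1 * r" using n1 assms by (simp add: field_simps)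
          also have "\<dots> \<le> real n * r" using elim assms by (intro mult_right_mono) auto
          finally show ?thesis .
        qed
        have "p ^ k = measure lborel (deviation_set m (real m * a) (real m * r)) ^ k"
          using m1 by (simp add: p_def prob_mean_cball)
        also have "\<dots> \<le> measure lborel
            (deviation_set (k * m) (real k * (real m * a)) (real k * (real m * r + real m * r)))"
          by (rule measure_deviation_set_power) (rule m0(2)[OF m])
        also have "\<dots> \<le> measure lborel (deviation_set n (real n * a) (real n * (3 * r)))"
        proof (rule measure_deviation_set_mono)
          fix u
          assume u: "u \<in> deviation_set (k * m) (real k * (real m * a)) (real k * (real m * r + real m * r))"
          define z where "z = S l (real (q ^ (k * m)) * u)"
          have "S n u = S (k * m) u + z" unfolding n z_def by (rule S_add)
          moreover have "real n * a = real k * (real m * a) + real l * a"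
            unfolding n by (simp add: algebra_simps)
          moreover have "\<bar>z\<bar> \<le> real l * K" unfolding z_def by (rule abs_S_le[OF K(2)])
          moreover have "\<bar>real l * a\<bar> = real l * \<bar>a\<bar>" by (simp add: abs_mult)
          moreover have "real l * (K + \<bar>a\<bar>) = real l * K + real l * \<bar>a\<bar>" by (rule distrib_left)
          moreover have "real k * (real m * r + real m * r) \<le> 2 * (real n * r)"
            using mult_right_mono[OF km, of r] assms by (simp add: algebra_simps)
          moreover have "\<bar>S (k * m) u - real k * (real m * a)\<bar> \<le> real k * (real m * r + real m * r)"
            "0 \<le> u" "u < 1" using u by (auto simp: deviation_set_def)
          ultimately show "u \<in> deviation_set n (real n * a) (real n * (3 * r))"
            using rem by (simp add: deviation_set_def)
        qed
        also have "\<dots> = prob_mean n (cball a (3 * r))" using elim by (simp add: prob_mean_cball)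
        finally have pk: "p ^ k \<le> prob_mean n (cball a (3 * r))" .
        have pos: "0 < prob_mean n (cball a (3 * r))"
          using zero_less_power[OF p(1), of k] pk by linarith
        have "ln (p ^ k) \<le> ln (prob_mean n (cball a (3 * r)))"
          using pk pos p by (intro ln_mono) auto
        then have "real k * ln p \<le> ln (prob_mean n (cball a (3 * r)))"
          using p by (simp add: ln_realpow)
        moreover have "real n / real m * ln p \<le> real k * ln p"
        proof (rule mult_right_mono_neg)
          show "real k \<le> real n / real m" using km m1 by (simp add: pos_le_divide_eq)
          show "ln p \<le> 0" using p by simp
        qed
        ultimately have "real n * (ln p / real m) \<le> ln (prob_mean n (cball a (3 * r)))"
          by simp
        then have "ln p / real m \<le> ln (prob_mean n (cball a (3 * r))) / real n"
          using elim by (simp add: pos_le_divide_eq mult.commute)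
        then show ?case
          using p pos by (simp add: rate_at_def ext_ln_def p_def)
      qed
    qed
  qed
  then show ?thesis
    by (intro Limsup_bounded) (auto simp: eventually_sequentially)
qed

section \<open>The rate function\<close>

text \<open>
  The rates grow as the radius decreases, so the supremum is their limit as the radius tends to
  \<open>0\<close>. The limes inferior in place of the limes superior would give the same function, by
  \<open>limsup_le_liminf_cball\<close>.
\<close>
definition ereal_rate :: "real \<Rightarrow> ereal" where
  "ereal_rate a = (SUP r\<in>{0<..}. - limsup (\<lambda>n. rate_at n (cball a r)))"

lemma ereal_rate_nonneg: "0 \<le> ereal_rate a"
proof -
  have "limsup (\<lambda>n. rate_at n (cball a 1)) \<le> ereal 0"
    by (rule limsup_rate_le[of 1]) (simp_all add: prob_mean_le_1)
  then have "0 \<le> - limsup (\<lambda>n. rate_at n (cball a 1))"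
    by (simp add: ereal_0_le_uminus_iff zero_ereal_def[symmetric])
  also have "\<dots> \<le> ereal_rate a" unfolding ereal_rate_def by (rule SUP_upper) simp
  finally show ?thesis .
qed

lemma less_ereal_rate_iff: "c < ereal_rate a \<longleftrightarrow> (\<exists>r>0. limsup (\<lambda>n. rate_at n (cball a r)) < - c)"
  unfolding ereal_rate_def less_SUP_iff by (auto simp: ereal_less_uminus_reorder)

text \<open>
  Strict superlevel sets are open, since a ball around \<open>x\<close> contains smaller balls around all points
  near \<open>x\<close>. Lower semicontinuity and closedness of the level sets both follow from this.
\<close>
lemma less_ereal_rate_nearby:
  assumes "c < ereal_rate x"
  obtains r where "r > 0" "\<And>y. dist y x < r \<Longrightarrow> c < ereal_rate y"
proof -
  obtain r where r: "r > 0" "limsup (\<lambda>n. rate_at n (cball x r)) < - c"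
    using assms unfolding less_ereal_rate_iff by blast
  show ?thesis
  proof (rule that[of "r / 2"])
    fix y assume y: "dist y x < r / 2"
    have "cball y (r / 2) \<subseteq> cball x r"
      using y by (intro cball_subset_cball_iff[THEN iffD2]) auto
    then have "limsup (\<lambda>n. rate_at n (cball y (r / 2))) \<le> limsup (\<lambda>n. rate_at n (cball x r))"
      by (intro Limsup_mono always_eventually allI rate_at_mono) auto
    then show "c < ereal_rate y" unfolding less_ereal_rate_iff using r by (intro exI[of _ "r / 2"]) auto
  qed (use r in simp)
qed

text \<open>The means never exceed a bound of \<open>\<bar>f\<bar>\<close>, which makes the level sets bounded.\<close>
lemma ereal_rate_eq_infinity:
  assumes "\<And>x. \<bar>f x\<bar> \<le> K" "\<bar>a\<bar> > K"
  shows "ereal_rate a = \<infinity>"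
proof (rule ereal_top)
  fix c
  define r where "r = (\<bar>a\<bar> - K) / 2"
  have r: "r > 0" using assms by (simp add: r_def)
  have "limsup (\<lambda>n. rate_at n (cball a r)) \<le> ereal (- c)"
  proof (rule limsup_rate_le)
    show "eventually (\<lambda>n. prob_mean n (cball a r) \<le> 1 * exp (real n * (- c))) sequentially"
      using eventually_ge_at_top[of 1]
    proof eventually_elim
      case (elim n)
      have "S n u / real n \<notin> cball a r" for u
      proof -
        have "\<bar>S n u / real n\<bar> \<le> K"
          using abs_S_le[OF assms(1), of n u] elim by (simp add: field_simps)
        then show ?thesis using r unfolding mem_cball dist_real_def r_def by argo
      qed
      then have "prob_mean n (cball a r) = 0" by (simp add: prob_mean_def)
      then show ?case by simp
    qed
  qed simp
  then have "ereal c \<le> - limsup (\<lambda>n. rate_at n (cball a r))"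
    by (subst ereal_minus_le_minus[symmetric]) simp
  also have "\<dots> \<le> ereal_rate a" unfolding ereal_rate_def using r by (intro SUP_upper) simp
  finally show "ereal c \<le> ereal_rate a" .
qed

definition I :: "real \<Rightarrow> ennreal" where
  "I a = e2ennreal (ereal_rate a)"

lemma enn2ereal_I: "enn2ereal (I a) = ereal_rate a"
  by (simp add: I_def enn2ereal_e2ennreal ereal_rate_nonneg)

lemma less_I_iff: "c < I a \<longleftrightarrow> enn2ereal c < ereal_rate a"
  by (simp add: less_ennreal.rep_eq enn2ereal_I)

lemma lower_semicontinuous_I: "lower_semicontinuous I"
  unfolding lower_semicontinuous_def le_Liminf_iff
proof (intro allI impI)
  fix x c assume "c < I x"
  then obtain r where "r > 0" "\<And>y. dist y x < r \<Longrightarrow> c < I y"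
    unfolding less_I_iff using less_ereal_rate_nearby by metis
  then show "eventually (\<lambda>y. c < I y) (at x)"
    unfolding eventually_at by blast
qed

lemma good_rate_function_I: "good_rate_function I"
  unfolding good_rate_function_def
proof (intro conjI lower_semicontinuous_I allI impI)
  fix c :: ennreal assume c: "c < \<infinity>"
  obtain K where K: "K > 0" "\<And>x. \<bar>f x\<bar> \<le> K"
    using bounded_f by blast
  have "open {x. c < I x}"
    unfolding open_dist less_I_iff using less_ereal_rate_nearby by (metis mem_Collect_eq)
  moreover have "{x. I x \<le> c} = - {x. c < I x}" by auto
  ultimately have "closed {x. I x \<le> c}" by (simp only: closed_Compl)
  moreover have "{x. I x \<le> c} \<subseteq> cball 0 K"
  proof
    fix x assume "x \<in> {x. I x \<le> c}"
    then have "I x \<noteq> \<infinity>" using c by auto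
    then have "ereal_rate x \<noteq> \<infinity>" by (auto simp: I_def)
    then have "\<bar>x\<bar> \<le> K" using ereal_rate_eq_infinity[OF K(2)] by (meson not_less)
    then show "x \<in> cball 0 K" by simp
  qed
  ultimately show "compact {x. I x \<le> c}"
    unfolding compact_eq_bounded_closed using bounded_cball bounded_subset by blast
qed

section \<open>The large deviation principle\<close>

text \<open>
  Every interior point \<open>x\<close> has a ball inside \<open>A\<close>, and \<open>limsup_le_liminf_cball\<close> bounds the limes
  inferior for this ball by the limes superior for the ball of a third of the radius, hence by the
  rate at \<open>x\<close>.
\<close>
lemma LDP_lower_bound:
  assumes "A \<in> sets borel"
  shows "- enn2ereal (INF x\<in>interior A. I x) \<le> liminf (\<lambda>n. rate_at n A)"
proof -
  let ?L = "liminf (\<lambda>n. rate_at n A)"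
  have "e2ennreal (- ?L) \<le> (INF x\<in>interior A. I x)"
  proof (rule INF_greatest)
    fix x assume "x \<in> interior A"
    then obtain r where r: "r > 0" "cball x r \<subseteq> A"
      by (auto simp: mem_interior_cball)
    have "limsup (\<lambda>n. rate_at n (cball x (r / 3))) \<le> liminf (\<lambda>n. rate_at n (cball x r))"
      using limsup_le_liminf_cball[of "r / 3" x] r by simp
    also have "\<dots> \<le> ?L"
      using r assms by (intro Liminf_mono always_eventually allI rate_at_mono) auto
    finally have "- ?L \<le> - limsup (\<lambda>n. rate_at n (cball x (r / 3)))" by simp
    also have "\<dots> \<le> ereal_rate x" unfolding ereal_rate_def using r by (intro SUP_upper) simp
    finally show "e2ennreal (- ?L) \<le> I x" unfolding I_def by (rule e2ennreal_mono)
  qed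
  then have "enn2ereal (e2ennreal (- ?L)) \<le> enn2ereal (INF x\<in>interior A. I x)"
    by (simp add: less_eq_ennreal.rep_eq)
  \<comment> \<open>The conversion to \<^typ>\<open>ennreal\<close> truncates negative values to \<open>0\<close>, so only \<open>\<le>\<close> holds.\<close>
  moreover have "- ?L \<le> enn2ereal (e2ennreal (- ?L))"
    by (cases "0 \<le> - ?L") (auto simp: enn2ereal_e2ennreal intro: order_trans[of _ 0])
  ultimately have "- ?L \<le> enn2ereal (INF x\<in>interior A. I x)" by (rule order_trans[rotated])
  then show ?thesis by (simp add: ereal_uminus_le_reorder)
qed

text \<open>
  If \<open>c\<close> is below the infimum of the rate function on the closure of \<open>A\<close>, then every point of the
  closure has a ball whose probability is eventually at most \<open>exp (- n c)\<close>. Finitely many of these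
  balls cover the part of the closure in \<open>[-K, K]\<close>, where the means lie.
\<close>
lemma LDP_upper_bound:
  assumes "A \<in> sets borel"
  shows "limsup (\<lambda>n. rate_at n A) \<le> - enn2ereal (INF x\<in>closure A. I x)"
proof (rule ccontr)
  let ?L = "limsup (\<lambda>n. rate_at n A)"
  assume "\<not> ?L \<le> - enn2ereal (INF x\<in>closure A. I x)"
  then have "- ?L < enn2ereal (INF x\<in>closure A. I x)"
    by (simp add: ereal_uminus_less_reorder not_le)
  then obtain c where c: "- ?L < ereal c" "ereal c < enn2ereal (INF x\<in>closure A. I x)"
    using ereal_dense2 by blast
  obtain K where K: "K > 0" "\<And>x. \<bar>f x\<bar> \<le> K"
    using bounded_f by blast
  have "\<exists>r>0. eventually (\<lambda>n. prob_mean n (cball x r) \<le> exp (real n * (- c))) sequentially"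
    if "x \<in> closure A" for x
  proof -
    have "(INF x\<in>closure A. I x) \<le> I x" using that by (rule INF_lower)
    then have "ereal c < ereal_rate x"
      using c(2) by (simp add: less_eq_ennreal.rep_eq enn2ereal_I)
    then obtain r where r: "r > 0" "limsup (\<lambda>n. rate_at n (cball x r)) < ereal (- c)"
      unfolding less_ereal_rate_iff by auto
    have "eventually (\<lambda>n. prob_mean n (cball x r) \<le> exp (real n * (- c))) sequentially"
      using Limsup_lessD[OF r(2)] eventually_ge_at_top[of 1]
    proof eventually_elim
      case (elim n)
      then show ?case using rate_at_le_iff[of n "cball x r" "- c"] less_imp_le by blast
    qed
    then show ?thesis using r(1) by blast
  qed
  then obtain r where r: "\<And>x. x \<in> closure A \<Longrightarrow> r x > 0"
    "\<And>x. x \<in> closure A \<Longrightarrow>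
      eventually (\<lambda>n. prob_mean n (cball x (r x)) \<le> exp (real n * (- c))) sequentially"
    by metis
  have "compact (closure A \<inter> cball 0 K)"
    by (intro closed_Int_compact) auto
  moreover have "closure A \<inter> cball 0 K \<subseteq> (\<Union>x\<in>closure A. ball x (r x))"
    using r(1) by auto
  ultimately obtain F where F: "F \<subseteq> closure A" "finite F"
    "closure A \<inter> cball 0 K \<subseteq> (\<Union>x\<in>F. ball x (r x))"
    using compactE_image[of "closure A \<inter> cball 0 K" "closure A" "\<lambda>x. ball x (r x)"] by auto
  have "eventually (\<lambda>n. \<forall>x\<in>F. prob_mean n (cball x (r x)) \<le> exp (real n * (- c))) sequentially"
    using F(1,2) r(2) by (intro eventually_ball_finite) auto
  \<comment> \<open>Adding \<open>1\<close> keeps the factor positive when \<open>F\<close> is empty.\<close>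
  then have "eventually (\<lambda>n. prob_mean n A \<le> (real (card F) + 1) * exp (real n * (- c))) sequentially"
    using eventually_ge_at_top[of 1]
  proof eventually_elim
    case (elim n)
    have "\<bar>S n u / real n\<bar> \<le> K" for u
      using abs_S_le[OF K(2), of n u] elim by (simp add: field_simps)
    then have "A \<inter> range (\<lambda>u. S n u / real n) \<subseteq> closure A \<inter> cball 0 K"
      using closure_subset[of A] by auto
    also have "\<dots> \<subseteq> (\<Union>x\<in>F. cball x (r x))"
      using F(3) ball_subset_cball by blast
    finally have "prob_mean n A \<le> (\<Sum>x\<in>F. prob_mean n (cball x (r x)))"
      using F(2) assms by (intro prob_mean_le_sum) auto
    also have "\<dots> \<le> real (card F) * exp (real n * (- c))"
      using elim by (intro sum_bounded_above) auto
    also have "\<dots> \<le> (real (card F) + 1) * exp (real n * (- c))" by (simp add: distrib_right)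
    finally show ?case .
  qed
  then have "?L \<le> ereal (- c)" by (intro limsup_rate_le) auto
  then have "ereal c \<le> - ?L" by (subst ereal_minus_le_minus[symmetric]) simp
  then show False using c(1) by simp
qed

lemma measure_mean_eq_prob_mean:
  assumes U: "U \<in> borel_measurable M"
    and distr: "distr M borel U = uniform_measure lborel {0..1}"
    and A: "A \<in> sets borel"
  shows "measure M {\<omega> \<in> space M. S n (U \<omega>) / real n \<in> A} = prob_mean n A"
proof -
  let ?E = "{u. S n u / real n \<in> A}"
  have E: "?E \<in> sets borel" using A by measurable
  have "measure M {\<omega> \<in> space M. S n (U \<omega>) / real n \<in> A} = measure (distr M borel U) ?E"
    using U E by (subst measure_distr) (auto intro!: arg_cong[where f = "measure M"])
  also have "\<dots> = measure lborel ({0..1} \<inter> ?E)"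
    unfolding distr using E by simp
  also have "\<dots> = prob_mean n A"
    unfolding prob_mean_def
  proof (rule measure_eq_AE)
    show "AE u in lborel. u \<in> {0..1} \<inter> ?E \<longleftrightarrow> u \<in> {u \<in> {0..<1}. S n u / real n \<in> A}"
      using AE_lborel_singleton[of "1::real"] by eventually_elim auto
  qed (use E fmeasurable_mean[OF A, of n] in \<open>auto simp: fmeasurable_def\<close>)
  finally show ?thesis .
qed

lemma satisfies_LDP_mean:
  assumes U: "U \<in> borel_measurable M"
    and distr: "distr M borel U = uniform_measure lborel {0..1}"
  shows "satisfies_LDP M (\<lambda>n \<omega>. S n (U \<omega>) / real n) (\<lambda>n. real n) I"
proof -
  have "(\<lambda>\<omega>. S n (U \<omega>) / real n) \<in> borel_measurable M" for n
    using U by measurable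
  moreover have "ereal (1 / real n) * ext_ln (measure M {\<omega> \<in> space M. S n (U \<omega>) / real n \<in> A})
      = rate_at n A" if "A \<in> sets borel" for A n
    by (simp add: rate_at_def measure_mean_eq_prob_mean[OF assms that])
  ultimately show ?thesis
    unfolding satisfies_LDP_def
    by (auto simp: lower_semicontinuous_I LDP_lower_bound LDP_upper_bound filterlim_real_sequentially
        intro!: Liminf_le_Limsup)
qed

end

theorem corollary1p2:
  fixes q :: nat and f :: "real \<Rightarrow> real"
  assumes "q \<ge> 2"
    and "continuous_on UNIV f"
    and "\<And>x. f (x + 1) = f x"
  shows "\<exists>I :: real \<Rightarrow> ennreal. good_rate_function I \<and>
    (\<forall>(M :: 'a measure) (U :: 'a \<Rightarrow> real).
       prob_space M \<longrightarrow> U \<in> borel_measurable M \<longrightarrow>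
       distr M borel U = uniform_measure lborel {0..1} \<longrightarrow>
       satisfies_LDP M (\<lambda>n \<omega>. (\<Sum>k=1..n. f (real (q ^ k) * U \<omega>)) / real n) (\<lambda>n. real n) I)"
proof -
  interpret lacunary q f
    using assms by unfold_locales
  show ?thesis
    using good_rate_function_I satisfies_LDP_mean unfolding S_def by blast
qed

end
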